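(* Let $\mathcal R$ be the reversibility operator, $(\mathcal R(\xi,\chi))(\theta):=(\xi(-\theta),-\chi(-\theta))$ for all $\theta\in\mathbb T^1$. Then the Hamiltonian $\mathcal H$, the angular momentum $\mathcal I$ and the mass $\mathcal M$ are $\mathcal R$-invariant and their $L^2$-gradients are $\mathcal R$-equivariant, that is, $$\mathcal H\circ\mathcal R=\mathcal H,\qquad\mathcal I\circ\mathcal R=\mathcal I,\qquad\mathcal M\circ\mathcal R=\mathcal M,$$ $$\nabla\mathcal H\circ\mathcal R=\mathcal R\circ\nabla\mathcal H,\qquad\nabla\mathcal I\circ\mathcal R=\mathcal R\circ\nabla\mathcal I,\qquad\nabla\mathcal M\circ\mathcal R=\mathcal R\circ\nabla\mathcal M.$$
   Context: $\sigma_0$ is a constant; $\mathbb T^1=\mathbb R/2\pi\mathbb Z$; $\xi,\chi:\mathbb T^1\to\mathbb R$ are sufficiently smooth; a prime denotes $\partial_\theta$. $\nabla A=(\partial_\xi A,\partial_\chi A)$ is the $L^2(\mathbb T^1)$-gradient of a functional $A(\xi,\chi)$. $$\mathcal H(\xi,\chi)=\frac12\int_{\mathbb T^1}\chi\,G(\xi)\chi\,d\theta+\sigma_0\int_{\mathbb T^1}e^{\xi}\sqrt{1+\xi'^2}\,d\theta-\frac{\sigma_0}2\int_{\mathbb T^1}e^{2\xi}\,d\theta,$$ $\mathcal I(\xi,\chi)=-\frac12\int_{\mathbb T^1}e^{2\xi}\chi'\,d\theta$, $\mathcal M(\xi,\chi)=\frac12\int_{\mathbb T^1}e^{2\xi}\,d\theta$.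 Here $G(\xi)\chi(\theta):=\partial_\rho\tilde\Phi(\xi(\theta),\theta)-\xi'(\theta)\partial_\theta\tilde\Phi(\xi(\theta),\theta)$, where $\tilde\Phi$ solves $\Delta\tilde\Phi=0$ in $\{(\rho,\theta)\in\mathbb R\times\mathbb T^1:\rho<\xi(\theta)\}$, $\tilde\Phi(\xi(\theta),\theta)=\chi(\theta)$, $\partial_\rho\tilde\Phi(\rho,\theta)\to0$ as $\rho\to-\infty$. *)

theory Defs
  imports "HOL-Analysis.Analysis" "HOL-Library.Extended_Nat"
begin

section \<open>Functions on the circle\<close>

text \<open>Functions on the circle of length \<open>2\<pi>\<close> are represented by \<open>2\<pi>\<close>-periodic functions on
  the reals; their integral is taken over one period.\<close>

definition periodic :: "(real \<Rightarrow> real) \<Rightarrow> bool" where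
  "periodic f \<longleftrightarrow> (\<forall>\<theta>. f (\<theta> + 2 * pi) = f \<theta>)"

definition circle_integral :: "(real \<Rightarrow> real) \<Rightarrow> real" where
  "circle_integral f = integral {0..2 * pi} f"

text \<open>Class \<open>C\<^sup>k\<close>, where \<open>k = \<infinity>\<close> is allowed.\<close>

definition Ck :: "enat \<Rightarrow> (real \<Rightarrow> real) \<Rightarrow> bool" where
  "Ck k f \<longleftrightarrow>
     (\<forall>j. enat j < k \<longrightarrow> (\<forall>x. (deriv ^^ j) f field_differentiable (at x))) \<and>
     (\<forall>j. enat j \<le> k \<longrightarrow> continuous_on UNIV ((deriv ^^ j) f))"

text \<open>A configuration \<open>(\<xi>, \<psi>)\<close> consists of the profile \<open>\<xi>\<close> and the boundary value \<open>\<psi>\<close> of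
  the potential (usually written chi, which is a binder in the imported theories).\<close>

type_synonym config = "(real \<Rightarrow> real) \<times> (real \<Rightarrow> real)"

definition phase_space :: "enat \<Rightarrow> config set" where
  "phase_space k = {(\<xi>, \<psi>). periodic \<xi> \<and> Ck k \<xi> \<and> periodic \<psi> \<and> Ck k \<psi>}"

section \<open>The Dirichlet-Neumann operator\<close>

text \<open>Points are pairs \<open>(\<rho>, \<theta>)\<close>. The partial derivatives are taken from the derivative of \<open>f\<close>
  relative to \<open>S\<close>: they are the usual ones when \<open>S\<close> is open, and make sense up to the
  boundary when \<open>S\<close> is the closed region below the graph of a differentiable function, where
  the derivative relative to \<open>S\<close> is unique.\<close>

definition d_rho :: "(real \<times> real) set \<Rightarrow> (real \<times> real \<Rightarrow> real) \<Rightarrow> real \<times> real \<Rightarrow> real" where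
  "d_rho S f p = frechet_derivative f (at p within S) (1, 0)"

definition d_theta :: "(real \<times> real) set \<Rightarrow> (real \<times> real \<Rightarrow> real) \<Rightarrow> real \<times> real \<Rightarrow> real" where
  "d_theta S f p = frechet_derivative f (at p within S) (0, 1)"

definition C1_on :: "(real \<times> real) set \<Rightarrow> (real \<times> real \<Rightarrow> real) \<Rightarrow> bool" where
  "C1_on S f \<longleftrightarrow>
     f differentiable_on S \<and> continuous_on S (d_rho S f) \<and> continuous_on S (d_theta S f)"

definition harmonic_on :: "(real \<times> real) set \<Rightarrow> (real \<times> real \<Rightarrow> real) \<Rightarrow> bool" where
  "harmonic_on S f \<longleftrightarrow>
     C1_on S f \<and> C1_on S (d_rho S f) \<and> C1_on S (d_theta S f) \<and>
     (\<forall>p\<in>S. d_rho S (d_rho S f) p + d_theta S (d_theta S f) p = 0)"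

definition fluid :: "(real \<Rightarrow> real) \<Rightarrow> (real \<times> real) set" where
  "fluid \<xi> = {(\<rho>, \<theta>). \<rho> < \<xi> \<theta>}"

definition closed_fluid :: "(real \<Rightarrow> real) \<Rightarrow> (real \<times> real) set" where
  "closed_fluid \<xi> = {(\<rho>, \<theta>). \<rho> \<le> \<xi> \<theta>}"

text \<open>The potential is \<open>C\<^sup>1\<close> up to the free boundary, so that its partial derivatives can be
  evaluated there, and the decay as \<open>\<rho> \<rightarrow> -\<infinity>\<close> is uniform in \<open>\<theta>\<close>.\<close>

definition is_potential ::
    "(real \<Rightarrow> real) \<Rightarrow> (real \<Rightarrow> real) \<Rightarrow> (real \<times> real \<Rightarrow> real) \<Rightarrow> bool" where
  "is_potential \<xi> \<psi> \<Phi> \<longleftrightarrow>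
     (\<forall>\<rho> \<theta>. \<rho> \<le> \<xi> \<theta> \<longrightarrow> \<Phi> (\<rho>, \<theta> + 2 * pi) = \<Phi> (\<rho>, \<theta>)) \<and>
     C1_on (closed_fluid \<xi>) \<Phi> \<and>
     harmonic_on (fluid \<xi>) \<Phi> \<and>
     (\<forall>\<theta>. \<Phi> (\<xi> \<theta>, \<theta>) = \<psi> \<theta>) \<and>
     uniform_limit UNIV (\<lambda>\<rho> \<theta>. d_rho (fluid \<xi>) \<Phi> (\<rho>, \<theta>)) (\<lambda>\<theta>. 0) at_bot"

definition is_dirichlet_neumann ::
    "(real \<Rightarrow> real) \<Rightarrow> (real \<Rightarrow> real) \<Rightarrow> (real \<Rightarrow> real) \<Rightarrow> bool" where
  "is_dirichlet_neumann \<xi> \<psi> f \<longleftrightarrow>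
     (\<exists>\<Phi>. is_potential \<xi> \<psi> \<Phi> \<and>
        f = (\<lambda>\<theta>. d_rho (closed_fluid \<xi>) \<Phi> (\<xi> \<theta>, \<theta>)
                 - deriv \<xi> \<theta> * d_theta (closed_fluid \<xi>) \<Phi> (\<xi> \<theta>, \<theta>)))"

text \<open>For periodic \<open>\<xi>\<close> and \<open>\<psi>\<close> of class \<open>C\<^sup>2\<close> the potential exists and is unique in the closed
  fluid region, by classical elliptic theory; the value 0 only makes the operator total.\<close>

definition dirichlet_neumann :: "(real \<Rightarrow> real) \<Rightarrow> (real \<Rightarrow> real) \<Rightarrow> real \<Rightarrow> real" where
  "dirichlet_neumann \<xi> \<psi> =
     (if \<exists>!f. is_dirichlet_neumann \<xi> \<psi> f then THE f. is_dirichlet_neumann \<xi> \<psi> f else (\<lambda>\<theta>. 0))"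

section \<open>Hamiltonian, angular momentum, mass\<close>

fun hamiltonian :: "real \<Rightarrow> config \<Rightarrow> real" where
  "hamiltonian \<sigma>\<^sub>0 (\<xi>, \<psi>) =
     1 / 2 * circle_integral (\<lambda>\<theta>. \<psi> \<theta> * dirichlet_neumann \<xi> \<psi> \<theta>)
     + \<sigma>\<^sub>0 * circle_integral (\<lambda>\<theta>. exp (\<xi> \<theta>) * sqrt (1 + (deriv \<xi> \<theta>)\<^sup>2))
     - \<sigma>\<^sub>0 / 2 * circle_integral (\<lambda>\<theta>. exp (2 * \<xi> \<theta>))"

fun angular_momentum :: "config \<Rightarrow> real" where
  "angular_momentum (\<xi>, \<psi>) = - (1 / 2) * circle_integral (\<lambda>\<theta>. exp (2 * \<xi> \<theta>) * deriv \<psi> \<theta>)"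

fun mass :: "config \<Rightarrow> real" where
  "mass (\<xi>, \<psi>) = 1 / 2 * circle_integral (\<lambda>\<theta>. exp (2 * \<xi> \<theta>))"

section \<open>Reversibility operator and gradients\<close>

fun reversibility :: "config \<Rightarrow> config" where
  "reversibility (\<xi>, \<psi>) = ((\<lambda>\<theta>. \<xi> (- \<theta>)), (\<lambda>\<theta>. - \<psi> (- \<theta>)))"

text \<open>The pair \<open>(g, h)\<close> of continuous functions on the circle represents, in the \<open>L\<^sup>2\<close> pairing,
  the directional derivatives of \<open>A\<close> at \<open>(\<xi>, \<psi>)\<close> in all directions \<open>(\<eta>, \<zeta>)\<close>.\<close>

fun has_L2_gradient :: "enat \<Rightarrow> (config \<Rightarrow> real) \<Rightarrow> config \<Rightarrow> config \<Rightarrow> bool" where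
  "has_L2_gradient k A (\<xi>, \<psi>) (g, h) \<longleftrightarrow>
     periodic g \<and> continuous_on UNIV g \<and> periodic h \<and> continuous_on UNIV h \<and>
     (\<forall>(\<eta>, \<zeta>) \<in> phase_space k.
        ((\<lambda>\<epsilon>. A ((\<lambda>\<theta>. \<xi> \<theta> + \<epsilon> * \<eta> \<theta>), (\<lambda>\<theta>. \<psi> \<theta> + \<epsilon> * \<zeta> \<theta>)))
           has_real_derivative
             (circle_integral (\<lambda>\<theta>. g \<theta> * \<eta> \<theta>) + circle_integral (\<lambda>\<theta>. h \<theta> * \<zeta> \<theta>))) (at 0))"

text \<open>The gradient is a partial map, with value \<open>None\<close> where \<open>A\<close> has no gradient.\<close>

definition L2_gradient :: "enat \<Rightarrow> (config \<Rightarrow> real) \<Rightarrow> config \<Rightarrow> config option" where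
  "L2_gradient k A u =
     (if \<exists>!g. has_L2_gradient k A u g then Some (THE g. has_L2_gradient k A u g) else None)"

end

theory Submission imports Defs begin

text \<open>If \<open>\<Phi>\<close> is the potential of \<open>(\<xi>, \<psi>)\<close>, then \<open>-\<Phi> \<circ> m\<close>, with \<open>m\<close> a reflection of the angle, is the
  potential of \<open>\<R>(\<xi>, \<psi>)\<close>; hence the Dirichlet-Neumann operator is equivariant. Together with the
  reflection invariance of the integral over a period this makes the three functionals invariant.
  Since \<open>\<R>\<close> is a linear involution that is symmetric for the \<open>L\<^sup>2\<close> pairing, the chain rule
  transfers invariance of a functional to equivariance of its gradient. The angle is reflected about
  \<open>\<pi>\<close> rather than \<open>0\<close>: on periodic functions this is the same operation, and it maps the integration
  interval to itself.\<close>

text \<open>The Dirichlet-Neumann operator and the gradient are both unique choices with a default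
  value. An involution that exchanges two predicates carries unique existence, and the object
  chosen, from one to the other.\<close>

lemma involution_ex1_the:
  assumes "\<And>x. P x \<Longrightarrow> Q (h x)" "\<And>y. Q y \<Longrightarrow> P (h y)" "\<And>x. h (h x) = x"
  shows "(\<exists>!y. Q y) \<longleftrightarrow> (\<exists>!x. P x)"
    and "\<exists>!x. P x \<Longrightarrow> (THE y. Q y) = h (THE x. P x)"
proof -
  show "(\<exists>!y. Q y) \<longleftrightarrow> (\<exists>!x. P x)"
    using assms by metis
  assume "\<exists>!x. P x"
  then have "P (THE x. P x)" and uniq: "\<And>x x'. P x \<Longrightarrow> P x' \<Longrightarrow> x = x'"
    by (rule theI') (use \<open>\<exists>!x. P x\<close> in blast)
  then show "(THE y. Q y) = h (THE x. P x)"
    using assms by (intro the_equality) metis+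
qed

section \<open>Periodic and smooth functions\<close>

lemma periodic_reflect: "periodic f \<Longrightarrow> f (- x) = f (2 * pi - x)"
  unfolding periodic_def by (metis add.commute uminus_add_conv_diff)

lemma periodic_reflect_fun: "periodic f \<Longrightarrow> (\<lambda>x. f (- x)) = (\<lambda>x. f (2 * pi - x))"
  using periodic_reflect by blast

lemma periodic_uminus_arg:
  assumes "periodic f" shows "periodic (\<lambda>x. f (- x))"
  unfolding periodic_def
proof
  fix x
  have "f (- (x + 2 * pi) + 2 * pi) = f (- (x + 2 * pi))"
    using assms unfolding periodic_def by blast
  then show "f (- (x + 2 * pi)) = f (- x)" by simp
qed

lemma periodic_uminus: "periodic f \<Longrightarrow> periodic (\<lambda>x. - f x)"
  by (simp add: periodic_def)

text \<open>The substitution has slope -1 and maps the period onto itself. Applied to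
  \<open>f\<close> and to its reflection, it shows that both have the same integrals; so
  integrability transfers too, and with it the default value of \<open>integral\<close>.\<close>

lemma circle_integral_reflect: "circle_integral (\<lambda>x. f (2 * pi - x)) = circle_integral f"
proof -
  have "(\<lambda>x. 2 * pi - x) ` {0..2 * pi} = {0..2 * pi}"
    using image_affinity_atLeastAtMost[of "- 1" "2 * pi" 0 "2 * pi"] by simp
  then have "((\<lambda>x. g (2 * pi - x)) has_integral i) {0..2 * pi}"
    if "(g has_integral i) {0..2 * pi}" for g :: "real \<Rightarrow> real" and i
    using has_integral_affinity[of g i 0 "2 * pi" "- 1" "2 * pi"] that
    by (simp add: add.commute)
  from this[of f] this[of "\<lambda>x. f (2 * pi - x)"]
  have "((\<lambda>x. f (2 * pi - x)) has_integral i) {0..2 * pi} \<longleftrightarrow> (f has_integral i) {0..2 * pi}" for i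
    by auto
  then show ?thesis
    unfolding circle_integral_def integral_def integrable_on_def by simp
qed

text \<open>Reflection is symmetric for the pairing: the product on the right, reflected about
  \<pi>, becomes the product on the left by periodicity.\<close>

lemma circle_integral_mult_reflect:
  assumes "periodic f" "periodic g"
  shows "circle_integral (\<lambda>x. f (- x) * g x) = circle_integral (\<lambda>x. f x * g (- x))"
  using circle_integral_reflect[of "\<lambda>x. f x * g (- x)"] periodic_reflect[OF assms(1)]
    periodic_reflect[OF assms(2), of "2 * pi - x" for x] by simp

lemma periodic_of_int:
  assumes "periodic f" shows "f (x + of_int n * (2 * pi)) = f x"
proof (induction n rule: int_induct[where k = 0])
  case (step1 i)
  then show ?case using assms unfolding periodic_def
    by (metis (no_types, opaque_lifting) add.assoc mult.commute mult.right_neutral of_int_1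
        of_int_add distrib_left)
next
  case (step2 i)
  have "f (x + of_int (i - 1) * (2 * pi) + 2 * pi) = f (x + of_int (i - 1) * (2 * pi))"
    using assms unfolding periodic_def by blast
  then show ?case using step2 by (simp add: algebra_simps)
qed simp

lemma periodic_bounded_below:
  assumes "periodic f" "continuous_on UNIV f"
  obtains m where "\<And>x. m < f x"
proof -
  have "continuous_on {0..2 * pi} f"
    using assms(2) continuous_on_subset by blast
  then obtain c where c: "\<And>y. y \<in> {0..2 * pi} \<Longrightarrow> f c \<le> f y"
    using continuous_attains_inf[of "{0..2 * pi}" f]
    by (metis atLeastatMost_empty_iff2 compact_Icc pi_ge_zero mult_nonneg_nonneg zero_le_numeral)
  have "f c \<le> f x" for x
  proof -
    \<comment> \<open>The representative of \<open>x\<close> modulo 2\<pi> in the period, where the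
      bound by \<open>f c\<close> is available.\<close>
    define y where "y = x + of_int (- \<lfloor>x / (2 * pi)\<rfloor>) * (2 * pi)"
    have "y = 2 * pi * frac (x / (2 * pi))"
      unfolding y_def frac_def by (simp add: field_simps)
    then have "y \<in> {0..2 * pi}"
      using frac_ge_0[of "x / (2 * pi)"] frac_lt_1[of "x / (2 * pi)"]
      by (simp add: mult_le_cancel_left1)
    then show ?thesis using c[of y] periodic_of_int[OF assms(1)] y_def by metis
  qed
  then show ?thesis using that[of "f c - 1"] by (meson less_le_trans diff_less_eq less_add_one)
qed

section \<open>Closure properties of the class C^k\<close>

lemma Ck_differentiable: "Ck k f \<Longrightarrow> 1 \<le> k \<Longrightarrow> f field_differentiable at x"
  unfolding Ck_def by (elim conjE allE[of _ "0::nat"]) (auto simp: zero_enat_def[symmetric] one_enat_def[symmetric])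

lemma Ck_add_scaled:
  assumes "Ck k f" "Ck k g"
  shows "Ck k (\<lambda>x. f x + c * g x)"
proof -
  have diff: "(deriv ^^ j) f field_differentiable at x" "(deriv ^^ j) g field_differentiable at x"
    if "enat j < k" for j x
    using assms that unfolding Ck_def by auto
  \<comment> \<open>The formula reaches order \<open>k\<close> itself: passing from \<open>j\<close>
    to \<open>Suc j\<close> differentiates once more, which \<open>enat j < k\<close>
    permits.\<close>
  have *: "(deriv ^^ j) (\<lambda>x. f x + c * g x) = (\<lambda>x. (deriv ^^ j) f x + c * (deriv ^^ j) g x)"
    if "enat j \<le> k" for j
    using that
  proof (induction j)
    case (Suc j)
    then have j: "enat j < k" by (simp add: Suc_ile_eq)
    have "deriv (\<lambda>x. (deriv ^^ j) f x + c * (deriv ^^ j) g x) x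
        = deriv ((deriv ^^ j) f) x + c * deriv ((deriv ^^ j) g) x" for x
      using diff[OF j] by (intro DERIV_imp_deriv DERIV_add DERIV_cmult field_differentiable_derivI)
    moreover have "(deriv ^^ j) (\<lambda>x. f x + c * g x) = (\<lambda>x. (deriv ^^ j) f x + c * (deriv ^^ j) g x)"
      using Suc.IH j by simp
    ultimately show ?case by auto
  qed simp
  show ?thesis
    unfolding Ck_def
  proof (intro conjI allI impI)
    fix j x assume "enat j < k"
    then show "(deriv ^^ j) (\<lambda>x. f x + c * g x) field_differentiable at x"
      using diff[of j x] *[of j] by (auto intro!: derivative_intros)
  next
    fix j assume "enat j \<le> k"
    then show "continuous_on UNIV ((deriv ^^ j) (\<lambda>x. f x + c * g x))"
      using assms *[of j] unfolding Ck_def by (auto intro!: continuous_intros)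
  qed
qed

lemma deriv_scaled_uminus_arg:
  assumes "f field_differentiable at (- x)"
  shows "((\<lambda>x. c * f (- x)) has_field_derivative - c * deriv f (- x)) (at (x::real))"
  using DERIV_cmult[OF DERIV_chain2[OF field_differentiable_derivI[OF assms] DERIV_minus[OF DERIV_ident]], of c]
  by simp

text \<open>Each differentiation contributes a factor -1, hence the power in the formula for order
  \<open>j\<close>. The values 1 and -1 of \<open>c\<close> cover the two components of
  \<open>reversibility\<close>.\<close>

lemma Ck_scaled_uminus_arg:
  assumes "Ck k f"
  shows "Ck k (\<lambda>x. c * f (- x))"
proof -
  have diff: "(deriv ^^ j) f field_differentiable at x" if "enat j < k" for j x
    using assms that unfolding Ck_def by auto
  have *: "(deriv ^^ j) (\<lambda>x. c * f (- x)) = (\<lambda>x. ((- 1) ^ j * c) * (deriv ^^ j) f (- x))"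
    if "enat j \<le> k" for j
    using that
  proof (induction j)
    case (Suc j)
    then have j: "enat j < k" by (simp add: Suc_ile_eq)
    have "deriv (\<lambda>x. ((- 1) ^ j * c) * (deriv ^^ j) f (- x)) x
        = - ((- 1) ^ j * c) * deriv ((deriv ^^ j) f) (- x)" for x
      by (intro DERIV_imp_deriv deriv_scaled_uminus_arg diff[OF j])
    moreover have "(deriv ^^ j) (\<lambda>x. c * f (- x)) = (\<lambda>x. ((- 1) ^ j * c) * (deriv ^^ j) f (- x))"
      using Suc.IH j by simp
    ultimately show ?case by auto
  qed simp
  show ?thesis
    unfolding Ck_def
  proof (intro conjI allI impI)
    fix j x assume j: "enat j < k"
    then show "(deriv ^^ j) (\<lambda>x. c * f (- x)) field_differentiable at x"
      using deriv_scaled_uminus_arg[OF diff[OF j]] *[of j]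
      by (auto simp: field_differentiable_def)
  next
    fix j assume j: "enat j \<le> k"
    then have "continuous_on UNIV ((deriv ^^ j) f)"
      using assms unfolding Ck_def by auto
    then have "continuous_on UNIV (\<lambda>x. (deriv ^^ j) f (- x))"
      by (rule continuous_on_compose2) (auto intro!: continuous_intros)
    then show "continuous_on UNIV ((deriv ^^ j) (\<lambda>x. c * f (- x)))"
      using *[OF j] by (auto intro!: continuous_intros)
  qed
qed

lemma deriv_reflect:
  assumes "\<And>x. f field_differentiable at (x::real)"
  shows "deriv (\<lambda>x. f (a - x)) x = - deriv f (a - x)"
proof (rule DERIV_imp_deriv)
  have "((\<lambda>x. a - x) has_field_derivative - 1) (at x)"
    by (auto intro!: derivative_eq_intros)
  from DERIV_chain2[OF field_differentiable_derivI[OF assms] this]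
  show "((\<lambda>x. f (a - x)) has_field_derivative - deriv f (a - x)) (at x)" by simp
qed

section \<open>Reflection of the potential\<close>

definition mirror :: "real \<times> real \<Rightarrow> real \<times> real" where
  "mirror p = (fst p, 2 * pi - snd p)"

lemma mirror_mirror [simp]: "mirror (mirror p) = p"
  by (simp add: mirror_def)

lemma mirror_image_iff: "p \<in> mirror ` S \<longleftrightarrow> mirror p \<in> S"
  by (metis imageE imageI mirror_mirror)

lemma mirror_image_mirror [simp]: "mirror ` mirror ` S = S"
  by (simp add: image_image)

lemma continuous_on_mirror: "continuous_on S mirror"
  unfolding mirror_def by (intro continuous_intros)

lemma has_derivative_mirror:
  "(mirror has_derivative (\<lambda>h. (fst h, - snd h))) (at p within S)"
  unfolding mirror_def by (auto intro!: derivative_eq_intros)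

text \<open>The factor \<open>c\<close> lets one statement serve both the potential, where
  \<open>c\<close> is -1, and its angular derivative, which picks up a further sign.\<close>

lemma has_derivative_compose_mirror:
  fixes f :: "real \<times> real \<Rightarrow> real"
  assumes "(f has_derivative F) (at p within S)"
  shows "((\<lambda>q. c * f (mirror q)) has_derivative (\<lambda>h. c * F (fst h, - snd h)))
    (at (mirror p) within mirror ` S)"
proof -
  have "(f has_derivative F) (at (mirror (mirror p)) within mirror ` mirror ` S)"
    using assms by simp
  from has_derivative_in_compose[OF has_derivative_mirror this]
  have "((\<lambda>q. f (mirror q)) has_derivative (\<lambda>h. F (fst h, - snd h))) (at (mirror p) within mirror ` S)" .
  then show ?thesis
    by (rule has_derivative_mult_right)
qed

text \<open>\<^const>\<open>frechet_derivative\<close> is a choice operator; it is determined on the following sets, which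
  need not be open.\<close>

definition unique_derivatives :: "(real \<times> real) set \<Rightarrow> bool" where
  "unique_derivatives S \<longleftrightarrow> (\<forall>p\<in>S. \<forall>(f :: real \<times> real \<Rightarrow> real) F F'.
     (f has_derivative F) (at p within S) \<longrightarrow> (f has_derivative F') (at p within S) \<longrightarrow> F = F')"

text \<open>A curve parallel to the graph through a point of \<open>S\<close> and the half-line below the point both
  stay in \<open>S\<close>; their tangents span the plane.\<close>

lemma unique_derivatives_below_graph:
  assumes diff: "\<And>x. \<xi> field_differentiable at x"
    and S: "\<And>\<rho> x y s. (\<rho>, x) \<in> S \<Longrightarrow> s \<ge> 0 \<Longrightarrow> (\<rho> + (\<xi> y - \<xi> x) - s, y) \<in> S"
  shows "unique_derivatives S"
  unfolding unique_derivatives_def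
proof (intro ballI allI impI)
  fix p and f :: "real \<times> real \<Rightarrow> real" and F F'
  assume p: "p \<in> S" and F: "(f has_derivative F) (at p within S)"
    and F': "(f has_derivative F') (at p within S)"
  obtain \<rho> x where px: "p = (\<rho>, x)" by fastforce
  define D where "D = deriv \<xi> x"
  define \<gamma> where "\<gamma> y = (\<rho> + (\<xi> y - \<xi> x), y)" for y
  define \<delta> where "\<delta> r = (r, x)" for r :: real
  have \<xi>': "(\<xi> has_derivative (\<lambda>h. D * h)) (at x)"
    using field_differentiable_derivI[OF diff] unfolding has_field_derivative_def D_def by blast
  have \<gamma>': "(\<gamma> has_derivative (\<lambda>h. (D * h, h))) (at x)"
    unfolding \<gamma>_def by (auto intro!: derivative_eq_intros \<xi>')
  have \<delta>': "(\<delta> has_derivative (\<lambda>h. (h, 0))) (at \<rho> within {..\<rho>})"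
    unfolding \<delta>_def by (auto intro!: derivative_eq_intros)
  have \<gamma>S: "range \<gamma> \<subseteq> S" and \<gamma>x: "\<gamma> x = p"
    using S[of \<rho> x 0] p px unfolding \<gamma>_def by auto
  have \<delta>S: "\<delta> ` {..\<rho>} \<subseteq> S" and \<delta>\<rho>: "\<delta> \<rho> = p"
    using S[of \<rho> x "\<rho> - r" x for r] p px unfolding \<delta>_def by auto
  have \<gamma>F: "((\<lambda>y. f (\<gamma> y)) has_derivative (\<lambda>h. E (D * h, h))) (at x)"
    if "(f has_derivative E) (at p within S)" for E
    using has_derivative_in_compose[OF \<gamma>', of f E] has_derivative_subset[OF that \<gamma>S] \<gamma>x by simp
  have \<delta>F: "((\<lambda>r. f (\<delta> r)) has_derivative (\<lambda>h. E (h, 0))) (at \<rho> within {..\<rho>})"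
    if "(f has_derivative E) (at p within S)" for E
    using has_derivative_in_compose[OF \<delta>', of f E] has_derivative_subset[OF that \<delta>S] \<delta>\<rho> by simp
  have "(\<lambda>h. F (D * h, h)) = (\<lambda>h. F' (D * h, h))"
    using has_derivative_unique[OF \<gamma>F[OF F] \<gamma>F[OF F']] .
  then have 1: "F (D, 1) = F' (D, 1)" by (metis mult.right_neutral)
  \<comment> \<open>In the closed region, a boundary point has only the half-line below it. The
    derivative along it is one-sided, and it is unique because this filter is nontrivial.\<close>
  have nontriv: "at \<rho> within {..\<rho>} \<noteq> bot"
    using trivial_limit_at_left_real[of \<rho>] by (simp add: at_within_Iic_at_left)
  have lin: "linear F" "linear F'"
    using F F' has_derivative_linear by auto
  have vec: "((\<lambda>r. f (\<delta> r)) has_vector_derivative E (1, 0)) (at \<rho> within {..\<rho>})"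
    if "(f has_derivative E) (at p within S)" for E
  proof -
    have "linear E" using that has_derivative_linear by auto
    have "(\<lambda>h. E (h, 0)) = (\<lambda>h. h *\<^sub>R E (1, 0))"
    proof (intro ext)
      fix h :: real
      have "(h, 0) = h *\<^sub>R (1, 0 :: real)" by simp
      then show "E (h, 0) = h *\<^sub>R E (1, 0)" by (simp only: linear_scale[OF \<open>linear E\<close>])
    qed
    then show ?thesis
      using \<delta>F[OF that] unfolding has_vector_derivative_def by metis
  qed
  have 2: "F (1, 0) = F' (1, 0)"
    using vector_derivative_unique_within[OF nontriv vec[OF F] vec[OF F']] .
  \<comment> \<open>The tangents \<open>(1, 0)\<close> of the half-line and \<open>(D, 1)\<close> of
    the curve form a basis, so the two values compared determine the linear map.\<close>
  have decomp: "E (a, b) = (a - b * D) * E (1, 0) + b * E (D, 1)"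
    if "linear E" for E :: "real \<times> real \<Rightarrow> real" and a b
  proof -
    have "(a, b) = (a - b * D) *\<^sub>R (1, 0) + b *\<^sub>R (D, 1)" by simp
    then show ?thesis
      by (simp only: linear_add[OF that] linear_scale[OF that] real_scaleR_def)
  qed
  show "F = F'"
  proof
    fix h
    show "F h = F' h"
      using decomp[OF lin(1), of "fst h" "snd h"] decomp[OF lin(2), of "fst h" "snd h"] 1 2
      by (simp only: prod.collapse)
  qed
qed

lemma unique_derivatives_fluid:
  assumes "\<And>x. \<xi> field_differentiable at x"
  shows "unique_derivatives (fluid \<xi>)" "unique_derivatives (closed_fluid \<xi>)"
  by (rule unique_derivatives_below_graph[OF assms]; simp add: fluid_def closed_fluid_def)+

text \<open>Two derivatives on the image pull back to two derivatives on \<open>S\<close>, and the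
  differential of \<open>mirror\<close> is invertible.\<close>

lemma unique_derivatives_mirror:
  assumes "unique_derivatives S" shows "unique_derivatives (mirror ` S)"
  unfolding unique_derivatives_def
proof (intro ballI allI impI)
  fix p and f :: "real \<times> real \<Rightarrow> real" and F F'
  assume p: "p \<in> mirror ` S" and F: "(f has_derivative F) (at p within mirror ` S)"
    and F': "(f has_derivative F') (at p within mirror ` S)"
  have "(\<lambda>h. F (fst h, - snd h)) = (\<lambda>h. F' (fst h, - snd h))"
    using has_derivative_compose_mirror[OF F, of 1] has_derivative_compose_mirror[OF F', of 1]
      assms p unfolding unique_derivatives_def by (simp add: mirror_image_iff)
  then have "F (fst h, - snd h) = F' (fst h, - snd h)" for h by metis
  from this[of "(fst h, - snd h)" for h] show "F = F'" by auto
qed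

section \<open>Partial derivatives and harmonicity under reflection\<close>

lemma frechet_derivative_unique_derivatives:
  fixes f :: "real \<times> real \<Rightarrow> real"
  assumes "unique_derivatives S" "p \<in> S" "(f has_derivative F) (at p within S)"
  shows "frechet_derivative f (at p within S) = F"
proof -
  have "(f has_derivative frechet_derivative f (at p within S)) (at p within S)"
    using differentiableI[OF assms(3)] by (simp only: frechet_derivative_works)
  then show ?thesis
    using assms unfolding unique_derivatives_def by blast
qed

text \<open>The differential of \<open>mirror\<close> fixes \<open>(1, 0)\<close> and negates
  \<open>(0, 1)\<close>; hence the extra sign in the angular derivative.\<close>

lemma d_mirror:
  assumes "unique_derivatives S" "f differentiable_on S" "p \<in> mirror ` S"
  shows "d_rho (mirror ` S) (\<lambda>q. c * f (mirror q)) p = c * d_rho S f (mirror p)"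
    and "d_theta (mirror ` S) (\<lambda>q. c * f (mirror q)) p = - c * d_theta S f (mirror p)"
proof -
  have "mirror p \<in> S" using assms(3) by (simp only: mirror_image_iff)
  let ?F = "frechet_derivative f (at (mirror p) within S)"
  have F: "(f has_derivative ?F) (at (mirror p) within S)"
    using assms \<open>mirror p \<in> S\<close> frechet_derivative_works unfolding differentiable_on_def by blast
  then have "?F (0, - 1) = - ?F (0, 1)"
    using linear_neg[OF has_derivative_linear, of f ?F _ "(0, 1)"] by simp
  moreover have "frechet_derivative (\<lambda>q. c * f (mirror q)) (at p within mirror ` S)
      = (\<lambda>h. c * ?F (fst h, - snd h))"
    using frechet_derivative_unique_derivatives[OF unique_derivatives_mirror[OF assms(1)] assms(3)]
      has_derivative_compose_mirror[OF F, of c] by simp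
  ultimately show
    "d_rho (mirror ` S) (\<lambda>q. c * f (mirror q)) p = c * d_rho S f (mirror p)"
    "d_theta (mirror ` S) (\<lambda>q. c * f (mirror q)) p = - c * d_theta S f (mirror p)"
    unfolding d_rho_def d_theta_def by simp_all
qed

lemma continuous_on_compose_mirror:
  fixes f :: "real \<times> real \<Rightarrow> real"
  assumes "continuous_on S f"
  shows "continuous_on (mirror ` S) (\<lambda>q. c * f (mirror q))"
  by (intro continuous_intros continuous_on_compose2[OF assms continuous_on_mirror]) auto

lemma C1_on_mirror:
  assumes "unique_derivatives S" "C1_on S f"
  shows "C1_on (mirror ` S) (\<lambda>q. c * f (mirror q))"
proof -
  have f: "f differentiable_on S" "continuous_on S (d_rho S f)" "continuous_on S (d_theta S f)"
    using assms(2) unfolding C1_on_def by auto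
  have "(\<lambda>q. c * f (mirror q)) differentiable_on mirror ` S"
    using f(1) has_derivative_compose_mirror unfolding differentiable_on_def differentiable_def
    by blast
  moreover have "continuous_on (mirror ` S) (d_rho (mirror ` S) (\<lambda>q. c * f (mirror q)))"
    using continuous_on_compose_mirror[OF f(2), of c] d_mirror(1)[OF assms(1) f(1)]
    by (metis (no_types, lifting) continuous_on_cong)
  moreover have "continuous_on (mirror ` S) (d_theta (mirror ` S) (\<lambda>q. c * f (mirror q)))"
    using continuous_on_compose_mirror[OF f(3), of "- c"] d_mirror(2)[OF assms(1) f(1)]
    by (metis (no_types, lifting) continuous_on_cong)
  ultimately show ?thesis unfolding C1_on_def by blast
qed

text \<open>Both functions have the same derivatives within \<open>S\<close>, so the choice operator
  picks the same one. This is used for second derivatives, as the first derivatives of a mirrored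
  function are known only on the region.\<close>

lemma frechet_derivative_cong_on:
  assumes "\<And>q. q \<in> S \<Longrightarrow> f q = g q" "p \<in> S"
  shows "frechet_derivative f (at p within S) = frechet_derivative g (at p within S)"
proof -
  have "(f has_derivative F) (at p within S) \<longleftrightarrow> (g has_derivative F) (at p within S)" for F
    using assms by (metis has_derivative_transform)
  then show ?thesis unfolding frechet_derivative_def by simp
qed

lemma d_cong:
  assumes "\<And>q. q \<in> S \<Longrightarrow> f q = g q" "p \<in> S"
  shows "d_rho S f p = d_rho S g p" "d_theta S f p = d_theta S g p"
  using frechet_derivative_cong_on[of S f g p] assms unfolding d_rho_def d_theta_def by auto

lemma C1_on_cong:
  assumes "\<And>q. q \<in> S \<Longrightarrow> f q = g q" "C1_on S f"
  shows "C1_on S g"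
proof -
  have "g differentiable_on S"
    using assms differentiable_transform_within[OF _ zero_less_one]
    unfolding C1_on_def differentiable_on_def by metis
  then show ?thesis
    using assms(2) continuous_on_cong[OF refl d_cong(1)[of S f g], of S] d_cong[of S f g] assms(1)
    unfolding C1_on_def by (metis (no_types, lifting) continuous_on_cong)
qed

text \<open>Two angular derivatives bring two signs, which cancel, so the Laplacian is pulled back
  with the factor \<open>c\<close> alone.\<close>

lemma harmonic_on_mirror:
  assumes U: "unique_derivatives S" and "harmonic_on S f"
  shows "harmonic_on (mirror ` S) (\<lambda>q. c * f (mirror q))"
proof -
  let ?S = "mirror ` S" and ?f = "\<lambda>q. c * f (mirror q)"
  have f: "C1_on S f" and fr: "C1_on S (d_rho S f)" and ft: "C1_on S (d_theta S f)"
    and lap: "\<And>p. p \<in> S \<Longrightarrow> d_rho S (d_rho S f) p + d_theta S (d_theta S f) p = 0"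
    using assms(2) unfolding harmonic_on_def by auto
  have diff: "f differentiable_on S" "d_rho S f differentiable_on S" "d_theta S f differentiable_on S"
    using f fr ft unfolding C1_on_def by auto
  have r: "c * d_rho S f (mirror q) = d_rho ?S ?f q"
    and t: "- c * d_theta S f (mirror q) = d_theta ?S ?f q" if "q \<in> ?S" for q
    using d_mirror[OF U diff(1) that] by auto
  have "d_rho ?S (d_rho ?S ?f) p + d_theta ?S (d_theta ?S ?f) p = 0" if p: "p \<in> ?S" for p
  proof -
    have "d_rho ?S (d_rho ?S ?f) p = c * d_rho S (d_rho S f) (mirror p)"
      using d_cong(1)[OF r p] d_mirror(1)[OF U diff(2) p, of c] by simp
    moreover have "d_theta ?S (d_theta ?S ?f) p = c * d_theta S (d_theta S f) (mirror p)"
      using d_cong(2)[OF t p] d_mirror(2)[OF U diff(3) p, of "- c"] by simp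
    ultimately show ?thesis
      using lap[of "mirror p"] p by (metis distrib_left mirror_image_iff mult_zero_right)
  qed
  then show ?thesis
    unfolding harmonic_on_def
    using C1_on_mirror[OF U f] C1_on_cong[OF r C1_on_mirror[OF U fr]]
      C1_on_cong[OF t C1_on_mirror[OF U ft]] by blast
qed

section \<open>Potential and Dirichlet-Neumann operator of the reflected configuration\<close>

lemma mirror_fluid:
  assumes "periodic \<xi>"
  shows "mirror ` fluid \<xi> = fluid (\<lambda>x. \<xi> (- x))"
    and "mirror ` closed_fluid \<xi> = closed_fluid (\<lambda>x. \<xi> (- x))"
  using periodic_reflect[OF assms]
  by (simp_all add: set_eq_iff mirror_image_iff) (simp_all add: fluid_def closed_fluid_def mirror_def)

lemma is_potential_mirror:
  assumes per: "periodic \<xi>" "periodic \<psi>" and diff: "\<And>x. \<xi> field_differentiable at x"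
    and \<Phi>: "is_potential \<xi> \<psi> \<Phi>"
  shows "is_potential (\<lambda>x. \<xi> (- x)) (\<lambda>x. - \<psi> (- x)) (\<lambda>q. - 1 * \<Phi> (mirror q))"
  unfolding is_potential_def
proof (intro conjI allI impI)
  note U = unique_derivatives_fluid[OF diff]
  note refl = periodic_reflect[OF per(1)] periodic_reflect[OF per(2)]
  have C1: "C1_on (closed_fluid \<xi>) \<Phi>" and harm: "harmonic_on (fluid \<xi>) \<Phi>"
    and lim: "uniform_limit UNIV (\<lambda>\<rho> \<theta>. d_rho (fluid \<xi>) \<Phi> (\<rho>, \<theta>)) (\<lambda>\<theta>. 0) at_bot"
    and bdry: "\<And>x. \<Phi> (\<xi> x, x) = \<psi> x"
    and per\<Phi>: "\<And>\<rho> x. \<rho> \<le> \<xi> x \<Longrightarrow> \<Phi> (\<rho>, x + 2 * pi) = \<Phi> (\<rho>, x)"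
    using \<Phi> unfolding is_potential_def by auto
  \<comment> \<open>The mirrored angles are \<open>- x\<close> and \<open>2 * pi - x\<close>, again
    one period apart.\<close>
  show "- 1 * \<Phi> (mirror (\<rho>, x + 2 * pi)) = - 1 * \<Phi> (mirror (\<rho>, x))" if "\<rho> \<le> \<xi> (- x)" for \<rho> x
    using per\<Phi>[OF that] by (simp add: mirror_def)
  show "C1_on (closed_fluid (\<lambda>x. \<xi> (- x))) (\<lambda>q. - 1 * \<Phi> (mirror q))"
    using C1_on_mirror[OF U(2) C1] mirror_fluid[OF per(1)] by metis
  show "harmonic_on (fluid (\<lambda>x. \<xi> (- x))) (\<lambda>q. - 1 * \<Phi> (mirror q))"
    using harmonic_on_mirror[OF U(1) harm] mirror_fluid[OF per(1)] by metis
  show "- 1 * \<Phi> (mirror (\<xi> (- x), x)) = - \<psi> (- x)" for x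
    using bdry[of "2 * pi - x"] refl by (simp add: mirror_def)
  have "continuous_on UNIV \<xi>"
    using diff field_differentiable_imp_continuous_at continuous_at_imp_continuous_on by blast
  \<comment> \<open>Below the depth \<open>m\<close> every angle lies in the fluid. The formula for
    the mirrored derivative holds there for all angles at once, as the uniform limit
    requires.\<close>
  then obtain m where m: "\<And>x. m < \<xi> x"
    using periodic_bounded_below per(1) by blast
  have "f differentiable_on fluid \<xi>" if "harmonic_on (fluid \<xi>) f" for f
    using that unfolding harmonic_on_def C1_on_def by blast
  note d = d_mirror(1)[OF U(1) this[OF harm], of _ "- 1"]
  have eq: "d_rho (fluid (\<lambda>x. \<xi> (- x))) (\<lambda>q. - 1 * \<Phi> (mirror q)) (\<rho>, x)
      = - d_rho (fluid \<xi>) \<Phi> (\<rho>, 2 * pi - x)" if "\<rho> \<le> m" for \<rho> x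
    using d[of "(\<rho>, x)"] that m[of "- x"] unfolding mirror_fluid[OF per(1)]
    by (simp add: fluid_def mirror_def)
  show "uniform_limit UNIV
      (\<lambda>\<rho> x. d_rho (fluid (\<lambda>x. \<xi> (- x))) (\<lambda>q. - 1 * \<Phi> (mirror q)) (\<rho>, x)) (\<lambda>x. 0) at_bot"
  proof (rule uniform_limitI)
    fix e :: real assume "e > 0"
    with lim have "\<forall>\<^sub>F \<rho> in at_bot. \<forall>x\<in>UNIV. dist (d_rho (fluid \<xi>) \<Phi> (\<rho>, x)) 0 < e"
      by (rule uniform_limitD)
    with eventually_le_at_bot[of m]
    show "\<forall>\<^sub>F \<rho> in at_bot. \<forall>x\<in>UNIV.
        dist (d_rho (fluid (\<lambda>x. \<xi> (- x))) (\<lambda>q. - 1 * \<Phi> (mirror q)) (\<rho>, x)) 0 < e"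
      by eventually_elim (simp only: eq dist_minus dist_0_norm norm_minus_cancel, simp)
  qed
qed

text \<open>With factor -1 the radial derivative changes sign. The angular derivative collects two
  signs and keeps its own, while \<open>deriv \<xi>\<close> changes sign. Both terms of the operator
  are therefore negated.\<close>

lemma is_dirichlet_neumann_mirror:
  assumes per: "periodic \<xi>" "periodic \<psi>" and diff: "\<And>x. \<xi> field_differentiable at x"
    and "is_dirichlet_neumann \<xi> \<psi> f"
  shows "is_dirichlet_neumann (\<lambda>x. \<xi> (- x)) (\<lambda>x. - \<psi> (- x)) (\<lambda>x. - f (2 * pi - x))"
proof -
  let ?\<xi> = "\<lambda>x. \<xi> (- x)" and ?S = "closed_fluid \<xi>" and ?S' = "closed_fluid (\<lambda>x. \<xi> (- x))"
  obtain \<Phi> where \<Phi>: "is_potential \<xi> \<psi> \<Phi>"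
    and f: "f = (\<lambda>x. d_rho ?S \<Phi> (\<xi> x, x) - deriv \<xi> x * d_theta ?S \<Phi> (\<xi> x, x))"
    using assms(4) unfolding is_dirichlet_neumann_def by blast
  let ?\<Phi> = "\<lambda>q. - 1 * \<Phi> (mirror q)"
  have "\<Phi> differentiable_on ?S"
    using \<Phi> unfolding is_potential_def C1_on_def by blast
  note d = d_mirror[OF unique_derivatives_fluid(2)[OF diff] this, of _ "- 1",
      unfolded mirror_fluid[OF per(1)]]
  have "d_rho ?S' ?\<Phi> (?\<xi> x, x) - deriv ?\<xi> x * d_theta ?S' ?\<Phi> (?\<xi> x, x) = - f (2 * pi - x)" for x
  proof -
    have "(?\<xi> x, x) \<in> ?S'" by (simp add: closed_fluid_def)
    moreover have "mirror (?\<xi> x, x) = (\<xi> (2 * pi - x), 2 * pi - x)"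
      using periodic_reflect[OF per(1)] by (simp add: mirror_def)
    moreover have "deriv ?\<xi> x = - deriv \<xi> (2 * pi - x)"
      unfolding periodic_reflect_fun[OF per(1)] by (rule deriv_reflect[OF diff])
    ultimately show ?thesis
      using d[of "(?\<xi> x, x)"] unfolding f by simp
  qed
  then show ?thesis
    unfolding is_dirichlet_neumann_def using is_potential_mirror[OF per diff \<Phi>]
    by (intro exI[of _ ?\<Phi>]) auto
qed

text \<open>The map \<open>?h\<close> is an involution that exchanges the two defining predicates,
  and it fixes the zero function, the default value.\<close>

lemma dirichlet_neumann_mirror:
  assumes per: "periodic \<xi>" "periodic \<psi>" and diff: "\<And>x. \<xi> field_differentiable at x"
  shows "dirichlet_neumann (\<lambda>x. \<xi> (- x)) (\<lambda>x. - \<psi> (- x)) = (\<lambda>x. - dirichlet_neumann \<xi> \<psi> (2 * pi - x))"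
proof -
  let ?h = "\<lambda>(f :: real \<Rightarrow> real) x. - f (2 * pi - x)"
  have "periodic (\<lambda>x. - \<psi> (- x))"
    using periodic_uminus_arg[OF per(2)] unfolding periodic_def by simp
  moreover have "(\<lambda>x. \<xi> (- x)) field_differentiable at x" for x
    using deriv_scaled_uminus_arg[OF diff, of 1] unfolding field_differentiable_def by auto
  \<comment> \<open>The forward direction applied to the reversed configuration, whose reversal is
    the original one.\<close>
  ultimately have bwd: "is_dirichlet_neumann \<xi> \<psi> (?h g)"
    if "is_dirichlet_neumann (\<lambda>x. \<xi> (- x)) (\<lambda>x. - \<psi> (- x)) g" for g
    using is_dirichlet_neumann_mirror[OF periodic_uminus_arg[OF per(1)] _ _ that] by simp
  note inv = involution_ex1_the[of "is_dirichlet_neumann \<xi> \<psi>"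
      "is_dirichlet_neumann (\<lambda>x. \<xi> (- x)) (\<lambda>x. - \<psi> (- x))" ?h,
      OF is_dirichlet_neumann_mirror[OF per diff] bwd]
  show ?thesis
    unfolding dirichlet_neumann_def using inv by auto
qed

section \<open>Invariance and equivariance\<close>

text \<open>In the kinetic term the signs of \<open>\<psi>\<close> and of the Dirichlet-Neumann
  operator cancel; \<open>deriv \<xi>\<close> enters squared. Each integrand is thus merely
  reflected.\<close>

lemma hamiltonian_reversibility:
  assumes "u \<in> phase_space k" "1 \<le> k"
  shows "hamiltonian \<sigma>\<^sub>0 (reversibility u) = hamiltonian \<sigma>\<^sub>0 u"
proof -
  obtain \<xi> \<psi> where u: "u = (\<xi>, \<psi>)" by fastforce
  have per: "periodic \<xi>" "periodic \<psi>" and diff: "\<And>x. \<xi> field_differentiable at x"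
    using assms Ck_differentiable unfolding phase_space_def u by auto
  note I = circle_integral_reflect[symmetric]
  have D: "deriv (\<lambda>x. \<xi> (- x)) = (\<lambda>x. - deriv \<xi> (2 * pi - x))"
    unfolding periodic_reflect_fun[OF per(1)] using deriv_reflect[OF diff] by blast
  show ?thesis
    unfolding u reversibility.simps hamiltonian.simps dirichlet_neumann_mirror[OF per diff] D
    unfolding I[of "\<lambda>x. \<psi> x * dirichlet_neumann \<xi> \<psi> x"] I[of "\<lambda>x. exp (2 * \<xi> x)"]
      I[of "\<lambda>x. exp (\<xi> x) * sqrt (1 + (deriv \<xi> x)\<^sup>2)"]
    by (simp add: periodic_reflect[OF per(1)] periodic_reflect[OF per(2)])
qed

lemma angular_momentum_reversibility:
  assumes "u \<in> phase_space k" "1 \<le> k"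
  shows "angular_momentum (reversibility u) = angular_momentum u"
proof -
  obtain \<xi> \<psi> where u: "u = (\<xi>, \<psi>)" by fastforce
  have per: "periodic \<xi>" "periodic \<psi>" and diff: "\<And>x. \<psi> field_differentiable at x"
    using assms Ck_differentiable unfolding phase_space_def u by auto
  \<comment> \<open>The sign of \<open>reversibility\<close> cancels the one from the chain rule.
    Differentiating \<open>\<psi> (- x)\<close> and \<open>\<psi> (2 * pi - x)\<close>, which agree,
    moves the centre of reflection.\<close>
  have "deriv (\<lambda>x. - \<psi> (- x)) = (\<lambda>x. deriv \<psi> (2 * pi - x))"
    using DERIV_imp_deriv[OF deriv_scaled_uminus_arg[OF diff, of "- 1"]]
      deriv_reflect[OF diff, of 0] deriv_reflect[OF diff, of "2 * pi"]
      periodic_reflect_fun[OF per(2)] by (simp add: fun_eq_iff)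
  then show ?thesis
    using circle_integral_reflect[of "\<lambda>x. exp (2 * \<xi> x) * deriv \<psi> x"]
    by (simp add: u periodic_reflect[OF per(1)])
qed

lemma mass_reversibility:
  assumes "u \<in> phase_space k"
  shows "mass (reversibility u) = mass u"
proof -
  obtain \<xi> \<psi> where u: "u = (\<xi>, \<psi>)" by fastforce
  have "periodic \<xi>" using assms unfolding phase_space_def u by auto
  then show ?thesis
    using circle_integral_reflect[of "\<lambda>x. exp (2 * \<xi> x)"] by (simp add: u periodic_reflect)
qed

section \<open>Equivariance of the gradients\<close>

lemma reversibility_reversibility: "reversibility (reversibility u) = u"
  by (cases u) simp

lemma reversibility_phase_space: "u \<in> phase_space k \<Longrightarrow> reversibility u \<in> phase_space k"
  using Ck_scaled_uminus_arg[of k _ 1] Ck_scaled_uminus_arg[of k _ "- 1"] periodic_uminus_arg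
  by (cases u) (auto simp: phase_space_def periodic_def)

text \<open>Invariance is assumed on the phase space, so the perturbed configurations in a
  directional derivative must stay in it.\<close>

lemma phase_space_add_scaled:
  assumes "(\<xi>, \<psi>) \<in> phase_space k" "(\<eta>, \<zeta>) \<in> phase_space k"
  shows "((\<lambda>x. \<xi> x + c * \<eta> x), (\<lambda>x. \<psi> x + c * \<zeta> x)) \<in> phase_space k"
  using assms Ck_add_scaled by (auto simp: phase_space_def periodic_def)

text \<open>Write R for \<open>reversibility\<close>. Invariance gives A(Ru + \<epsilon>v) = A(u +
  \<epsilon>Rv), so the derivative at Ru along v is the pairing of w with Rv, which equals that of
  Rw with v.\<close>

lemma has_L2_gradient_reversibility:
  assumes A: "\<And>v. v \<in> phase_space k \<Longrightarrow> A (reversibility v) = A v"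
    and u: "u \<in> phase_space k" and grad: "has_L2_gradient k A u w"
  shows "has_L2_gradient k A (reversibility u) (reversibility w)"
proof -
  obtain \<xi> \<psi> where u': "u = (\<xi>, \<psi>)" by fastforce
  obtain g h where w: "w = (g, h)" by fastforce
  have per: "periodic g" "periodic h" and cont: "continuous_on UNIV g" "continuous_on UNIV h"
    and D: "\<And>\<eta> \<zeta>. (\<eta>, \<zeta>) \<in> phase_space k \<Longrightarrow>
      ((\<lambda>\<epsilon>. A ((\<lambda>x. \<xi> x + \<epsilon> * \<eta> x), (\<lambda>x. \<psi> x + \<epsilon> * \<zeta> x))) has_real_derivative
        (circle_integral (\<lambda>x. g x * \<eta> x) + circle_integral (\<lambda>x. h x * \<zeta> x))) (at 0)"
    using grad unfolding u' w by auto
  have cont': "continuous_on UNIV (\<lambda>x. f (- x))" if "continuous_on UNIV f" for f :: "real \<Rightarrow> real"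
    by (rule continuous_on_compose2[OF that]) (auto intro!: continuous_intros)
  have "((\<lambda>\<epsilon>. A ((\<lambda>x. \<xi> (- x) + \<epsilon> * \<eta> x), (\<lambda>x. - \<psi> (- x) + \<epsilon> * \<zeta> x))) has_real_derivative
      (circle_integral (\<lambda>x. g (- x) * \<eta> x) + circle_integral (\<lambda>x. - h (- x) * \<zeta> x))) (at 0)"
    if v: "(\<eta>, \<zeta>) \<in> phase_space k" for \<eta> \<zeta>
  proof -
    have v': "((\<lambda>x. \<eta> (- x)), (\<lambda>x. - \<zeta> (- x))) \<in> phase_space k"
      using reversibility_phase_space[OF v] by simp
    have per': "periodic \<eta>" "periodic \<zeta>" using v unfolding phase_space_def by auto
    have "A ((\<lambda>x. \<xi> (- x) + \<epsilon> * \<eta> x), (\<lambda>x. - \<psi> (- x) + \<epsilon> * \<zeta> x))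
        = A ((\<lambda>x. \<xi> x + \<epsilon> * \<eta> (- x)), (\<lambda>x. \<psi> x + \<epsilon> * (- \<zeta> (- x))))" for \<epsilon>
      using A[OF phase_space_add_scaled[OF u[unfolded u'] v', of \<epsilon>]] by simp
    \<comment> \<open>In the second component the symmetry of the pairing is applied to the negated
      direction, to account for the sign in \<open>reversibility\<close>.\<close>
    then show ?thesis
      using D[OF v'] circle_integral_mult_reflect[OF per(1) per'(1)]
        circle_integral_mult_reflect[OF per(2) periodic_uminus[OF per'(2)]] by simp
  qed
  then show ?thesis
    unfolding u' w
    using periodic_uminus_arg[OF per(1)] periodic_uminus_arg[OF per(2)] cont'[OF cont(1)] cont'[OF cont(2)]
    by (auto simp: periodic_def intro!: continuous_intros)
qed

text \<open>Unique existence transfers along the involution, so both sides are \<open>None\<close>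
  together; otherwise the chosen gradients correspond.\<close>

lemma L2_gradient_reversibility:
  assumes A: "\<And>v. v \<in> phase_space k \<Longrightarrow> A (reversibility v) = A v"
    and u: "u \<in> phase_space k"
  shows "L2_gradient k A (reversibility u) = map_option reversibility (L2_gradient k A u)"
proof -
  have fwd: "has_L2_gradient k A (reversibility u) (reversibility w)" if "has_L2_gradient k A u w" for w
    using has_L2_gradient_reversibility A u that by blast
  have "has_L2_gradient k A u (reversibility w)" if "has_L2_gradient k A (reversibility u) w" for w
    using has_L2_gradient_reversibility[OF _ reversibility_phase_space[OF u] that] A
    by (simp add: reversibility_reversibility)
  note inv = involution_ex1_the[of "has_L2_gradient k A u" "has_L2_gradient k A (reversibility u)"
      reversibility, OF fwd this reversibility_reversibility]
  show ?thesis
    unfolding L2_gradient_def using inv by auto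
qed

theorem lemma3p7:
  fixes \<sigma>\<^sub>0 :: real and k :: enat
  assumes "2 \<le> k"
  shows "\<forall>u\<in>phase_space k.
      hamiltonian \<sigma>\<^sub>0 (reversibility u) = hamiltonian \<sigma>\<^sub>0 u \<and>
      angular_momentum (reversibility u) = angular_momentum u \<and>
      mass (reversibility u) = mass u \<and>
      L2_gradient k (hamiltonian \<sigma>\<^sub>0) (reversibility u)
        = map_option reversibility (L2_gradient k (hamiltonian \<sigma>\<^sub>0) u) \<and>
      L2_gradient k angular_momentum (reversibility u)
        = map_option reversibility (L2_gradient k angular_momentum u) \<and>
      L2_gradient k mass (reversibility u)
        = map_option reversibility (L2_gradient k mass u)"
proof -
  have "(1::enat) \<le> 2" by (simp add: one_enat_def numeral_eq_enat)
  then have "1 \<le> k" using assms by (rule order_trans)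
  then show ?thesis
    using hamiltonian_reversibility angular_momentum_reversibility mass_reversibility
    by (intro ballI conjI L2_gradient_reversibility) blast+
qed

end
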